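(* One has $\mathcal{T}^{1,\infty}(\mathbb{R}^2)=L^{1,\infty}(\mathbb{R}^2)$ with equivalent quasi-norms.
   Context: A parabolic box is a set $Q=Q(z,\rho)=z+[-\rho,\rho]\times[-\rho^2,\rho^2]$ with $z\in\mathbb{R}^2$, $\rho>0$; its side length is $\rho_Q=\rho$. Put $Q^*=Q(z,4\rho_Q)$, and for $R\ge\rho_Q$ define the tendril $T(Q,R)=Q^*+\{(t,t^2):|t|\le R\}$. A tendril cover of a measurable set $E\subseteq\mathbb{R}^2$ is a countable family $\{(\theta_i,T(Q_i,R_i))\}_{i\ge1}$ with $Q_i$ parabolic boxes, $\theta_i\ge0$, $R_i\ge\rho_{Q_i}$, such that $\mathbf{1}_E(x)\le\sum_{i\ge1}\theta_i\mathbf{1}_{T(Q_i,R_i)}(x)$ for almost every $x\in\mathbb{R}^2$. For $0<p\le1$, the $p$-tendril content of $E$ is $C_p(E)=\inf\sum_{i\ge1}\theta_i\rho_{Q_i}R_i^{2p}$, the infimum over all tendril covers of $E$. The weak tendril space $\mathcal{T}^{p,\infty}(\mathbb{R}^2)$ consists of all measurable $f$ on $\mathbb{R}^2$ with $\|f\|_{\mathcal{T}^{p,\infty}(\mathbb{R}^2)}^p:=\sup_{\alpha>0}\alpha^pC_p(\{|f|>\alpha\})<\infty$. $L^{1,\infty}(\mathbb{R}^2)$ is the space of measurable $f$ on $\mathbb{R}^2$ with $\|f\|_{L^{1,\infty}(\mathbb{R}^2)}=\sup_{\alpha>0}\alpha\,|\{|f|>\alpha\}|<\infty$. *)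

theory Defs
  imports "HOL-Analysis.Analysis"
begin

text \<open>The plane is \<^typ>\<open>real \<times> real\<close>. A parabolic box determines its centre \<open>z\<close> and side length \<open>\<rho>\<close>,
  so the notions depending on a box are parametrised by \<open>z\<close> and \<open>\<rho>\<close>.\<close>

definition parabolic_box :: "real \<times> real \<Rightarrow> real \<Rightarrow> (real \<times> real) set" where
  "parabolic_box z \<rho> = {z + v | v. v \<in> {-\<rho>..\<rho>} \<times> {-(\<rho>\<^sup>2)..\<rho>\<^sup>2}}"

definition tendril :: "real \<times> real \<Rightarrow> real \<Rightarrow> real \<Rightarrow> (real \<times> real) set" where
  "tendril z \<rho> R = {q + (t, t\<^sup>2) | q t. q \<in> parabolic_box z (4 * \<rho>) \<and> \<bar>t\<bar> \<le> R}"

text \<open>Countable families are sequences: a finite family is padded with terms of weight 0.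
  The sums are in \<^typ>\<open>ennreal\<close>, so they may be infinite.\<close>

definition tendril_cover ::
  "(real \<times> real) set \<Rightarrow> (nat \<Rightarrow> real) \<Rightarrow> (nat \<Rightarrow> real \<times> real) \<Rightarrow> (nat \<Rightarrow> real) \<Rightarrow> (nat \<Rightarrow> real) \<Rightarrow> bool"
where
  "tendril_cover E \<theta> z \<rho> R \<longleftrightarrow>
     (\<forall>i. 0 \<le> \<theta> i \<and> 0 < \<rho> i \<and> \<rho> i \<le> R i) \<and>
     (AE x in lebesgue. indicator E x \<le> (\<Sum>i. ennreal (\<theta> i) * indicator (tendril (z i) (\<rho> i) (R i)) x))"

definition tendril_content :: "real \<Rightarrow> (real \<times> real) set \<Rightarrow> ennreal" where
  "tendril_content p E =
     Inf {\<Sum>i. ennreal (\<theta> i * \<rho> i * R i powr (2 * p)) | \<theta> z \<rho> R. tendril_cover E \<theta> z \<rho> R}"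

text \<open>The \<open>p\<close>-th power of the quasi-norm, followed by the quasi-norm itself.\<close>

definition weak_tendril_norm_pow :: "real \<Rightarrow> (real \<times> real \<Rightarrow> 'b::euclidean_space) \<Rightarrow> ennreal" where
  "weak_tendril_norm_pow p f =
     (SUP \<alpha>\<in>{0<..}. ennreal (\<alpha> powr p) * tendril_content p {x. norm (f x) > \<alpha>})"

definition weak_tendril_norm :: "real \<Rightarrow> (real \<times> real \<Rightarrow> 'b::euclidean_space) \<Rightarrow> ennreal" where
  "weak_tendril_norm p f =
     (if weak_tendril_norm_pow p f = \<infinity> then \<infinity>
      else ennreal (enn2real (weak_tendril_norm_pow p f) powr (1 / p)))"

definition weak_tendril_space :: "real \<Rightarrow> (real \<times> real \<Rightarrow> 'b::euclidean_space) set" where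
  "weak_tendril_space p = {f \<in> borel_measurable lebesgue. weak_tendril_norm_pow p f < \<infinity>}"

definition weak_L1_norm :: "(real \<times> real \<Rightarrow> 'b::euclidean_space) \<Rightarrow> ennreal" where
  "weak_L1_norm f = (SUP \<alpha>\<in>{0<..}. ennreal \<alpha> * emeasure lebesgue {x. norm (f x) > \<alpha>})"

definition weak_L1 :: "(real \<times> real \<Rightarrow> 'b::euclidean_space) set" where
  "weak_L1 = {f \<in> borel_measurable lebesgue. weak_L1_norm f < \<infinity>}"

end

theory Submission
  imports Defs
begin

text \<open>For \<open>p = 1\<close> the tendril content is comparable to Lebesgue measure. Shearing by the parabola
  shows that a tendril lies in a neighbourhood of a parabolic arc of measure at most \<open>800 \<rho> R\<^sup>2\<close>, so
  integrating a cover bounds the measure of the covered set. Conversely, an open set is a disjoint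
  union of dyadic parabolic boxes, and a box of width \<open>\<rho>\<close> and height \<open>\<rho>\<^sup>2\<close> is contained in the
  tendril with \<open>R = \<rho>\<close>, whose cost \<open>\<rho>\<^sup>3\<close> is the measure of the box; outer regularity does the
  rest.\<close>

subsection \<open>The measure of a tendril\<close>

text \<open>A vertical neighbourhood of the parabolic arc with vertex \<open>z\<close>, simple
  enough to be measured slice by slice; it serves as a measurable superset of a tendril.\<close>

definition parabolic_strip :: "real \<times> real \<Rightarrow> real \<Rightarrow> real \<Rightarrow> (real \<times> real) set" where
  "parabolic_strip z a h =
     {x. \<bar>fst x - fst z\<bar> \<le> a \<and> \<bar>snd x - snd z - (fst x - fst z)\<^sup>2\<bar> \<le> h}"

lemma parabolic_strip_borel: "parabolic_strip z a h \<in> sets borel"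
proof -
  have "closed (parabolic_strip z a h)"
    unfolding parabolic_strip_def
    by (intro closed_Collect_conj closed_Collect_le continuous_intros)
  then show ?thesis by simp
qed

text \<open>Every nonempty vertical slice is an interval of length \<open>2 * h\<close>, wherever
  the arc shifts it, so Tonelli gives the same area as for a rectangle with sides
  \<open>2 * a\<close> and \<open>2 * h\<close>.\<close>

lemma emeasure_parabolic_strip:
  assumes "0 \<le> a" "0 \<le> h"
  shows "emeasure lborel (parabolic_strip z a h) = ennreal (4 * a * h)"
proof -
  have slice: "emeasure lborel (Pair x -` parabolic_strip z a h)
      = ennreal (2 * h) * indicator {fst z - a..fst z + a} x" for x
  proof (cases "\<bar>x - fst z\<bar> \<le> a")
    case True
    then have "Pair x -` parabolic_strip z a h
        = {snd z + (x - fst z)\<^sup>2 - h..snd z + (x - fst z)\<^sup>2 + h}"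
      by (auto simp: parabolic_strip_def abs_le_iff)
    then show ?thesis using True assms by (auto simp: indicator_def abs_le_iff)
  next
    case False
    then have "Pair x -` parabolic_strip z a h = {}"
      by (auto simp: parabolic_strip_def)
    then show ?thesis using False by (auto simp: indicator_def abs_le_iff)
  qed
  have "emeasure lborel (parabolic_strip z a h)
      = emeasure (lborel \<Otimes>\<^sub>M lborel) (parabolic_strip z a h)"
    by (simp add: lborel_prod)
  also have "\<dots> = (\<integral>\<^sup>+x. emeasure lborel (Pair x -` parabolic_strip z a h) \<partial>lborel)"
    by (rule lborel.emeasure_pair_measure_alt) (simp only: lborel_prod sets_lborel parabolic_strip_borel)
  also have "\<dots> = ennreal (2 * h) * ennreal (2 * a)"
    using assms by (simp add: slice nn_integral_cmult_indicator)
  also have "\<dots> = ennreal (4 * a * h)"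
    using assms by (simp add: ennreal_mult[symmetric] mult_ac)
  finally show ?thesis .
qed

text \<open>The squares of \<open>t\<close> cancel: the point \<open>z + (a, b) + (t, t^2)\<close>
  lies at signed height \<open>b - a^2 - 2 * a * t\<close> over the parabola with vertex
  \<open>z\<close>. The three terms are at most \<open>16 * \<rho>^2\<close>,
  \<open>16 * \<rho>^2\<close> and \<open>8 * \<rho> * R\<close>, and \<open>\<rho> \<le> R\<close>
  yields the factor 40. The half-width is at most \<open>4 * \<rho> + R \<le> 5 * R\<close>.\<close>

lemma tendril_subset_parabolic_strip:
  assumes "0 < \<rho>" "\<rho> \<le> R"
  shows "tendril z \<rho> R \<subseteq> parabolic_strip z (5 * R) (40 * \<rho> * R)"
proof
  fix x assume "x \<in> tendril z \<rho> R"
  then obtain a b t where x: "x = z + (a, b) + (t, t\<^sup>2)" and a: "\<bar>a\<bar> \<le> 4 * \<rho>"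
    and b: "\<bar>b\<bar> \<le> (4 * \<rho>)\<^sup>2" and t: "\<bar>t\<bar> \<le> R"
  proof -
    obtain v t where "x = z + v + (t, t\<^sup>2)" "\<bar>t\<bar> \<le> R"
      "v \<in> {-(4 * \<rho>)..4 * \<rho>} \<times> {-((4 * \<rho>)\<^sup>2)..(4 * \<rho>)\<^sup>2}"
      using \<open>x \<in> tendril z \<rho> R\<close> unfolding tendril_def parabolic_box_def by blast
    then show thesis
      by (intro that[of "fst v" "snd v" t]) (auto simp: mem_Times_iff abs_le_iff)
  qed
  have four: "(4 * \<rho>)\<^sup>2 = 16 * \<rho>\<^sup>2" by (simp add: power_mult_distrib)
  have a2: "\<bar>a\<^sup>2\<bar> \<le> (4 * \<rho>)\<^sup>2"
    using power_mono[OF a, of 2] by simp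
  have "\<bar>a * t\<bar> \<le> (4 * \<rho>) * R"
    using mult_mono[OF a t] assms by (simp add: abs_mult)
  moreover have "\<rho>\<^sup>2 \<le> \<rho> * R"
    using assms by (simp add: power2_eq_square)
  moreover have "snd x - snd z - (fst x - fst z)\<^sup>2 = b - a\<^sup>2 - 2 * (a * t)"
    by (simp add: x power2_eq_square algebra_simps)
  ultimately have "\<bar>snd x - snd z - (fst x - fst z)\<^sup>2\<bar> \<le> 40 * \<rho> * R"
    using b a2 four by linarith
  moreover have "\<bar>fst x - fst z\<bar> \<le> 5 * R"
    using a t assms by (simp add: x)
  ultimately show "x \<in> parabolic_strip z (5 * R) (40 * \<rho> * R)"
    by (simp add: parabolic_strip_def)
qed

lemma emeasure_le_tendril_content:
  assumes E: "E \<in> sets lebesgue"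
  shows "emeasure lebesgue E \<le> ennreal 800 * tendril_content 1 E"
proof -
  have bound: "emeasure lebesgue E \<le> ennreal 800 * (\<Sum>i. ennreal (\<theta> i * \<rho> i * R i powr (2 * 1)))"
    if cover: "tendril_cover E \<theta> z \<rho> R" for \<theta> z \<rho> R
  proof -
    have pos: "0 \<le> \<theta> i" "0 < \<rho> i" "\<rho> i \<le> R i" for i
      using cover by (auto simp: tendril_cover_def)
    \<comment> \<open>The strips replace the tendrils under the integral; they are measurable and
      have area \<open>4 * (5 * R) * (40 * \<rho> * R)\<close>, which is the source of 800.\<close>
    define S where "S i = parabolic_strip (z i) (5 * R i) (40 * \<rho> i * R i)" for i
    have S: "S i \<in> sets lebesgue" for i
      unfolding S_def using parabolic_strip_borel by simp
    have "emeasure lebesgue E = (\<integral>\<^sup>+x. indicator E x \<partial>lebesgue)"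
      using E by simp
    also have "\<dots> \<le> (\<integral>\<^sup>+x. (\<Sum>i. ennreal (\<theta> i) * indicator (S i) x) \<partial>lebesgue)"
    proof (rule nn_integral_mono_AE)
      have sub: "tendril (z i) (\<rho> i) (R i) \<subseteq> S i" for i
        unfolding S_def by (rule tendril_subset_parabolic_strip[OF pos(2,3)])
      have mono: "(\<Sum>i. ennreal (\<theta> i) * indicator (tendril (z i) (\<rho> i) (R i)) x)
          \<le> (\<Sum>i. ennreal (\<theta> i) * indicator (S i) x)" for x
        by (intro suminf_le mult_left_mono summableI)
           (auto simp: indicator_def dest: subsetD[OF sub])
      have "AE x in lebesgue. indicator E x
          \<le> (\<Sum>i. ennreal (\<theta> i) * indicator (tendril (z i) (\<rho> i) (R i)) x)"
        using cover by (simp add: tendril_cover_def)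
      then show "AE x in lebesgue. indicator E x \<le> (\<Sum>i. ennreal (\<theta> i) * indicator (S i) x)"
        by (rule eventually_mono) (erule order_trans[OF _ mono])
    qed
    also have "\<dots> = (\<Sum>i. ennreal (\<theta> i) * emeasure lebesgue (S i))"
      using S by (subst nn_integral_suminf) (auto simp: nn_integral_cmult_indicator)
    also have "\<dots> = (\<Sum>i. ennreal 800 * ennreal (\<theta> i * \<rho> i * R i powr (2 * 1)))"
    proof (rule suminf_cong)
      fix i
      have R: "0 < R i" using pos(2,3)[of i] by linarith
      have "emeasure lebesgue (S i) = ennreal (4 * (5 * R i) * (40 * \<rho> i * R i))"
        unfolding S_def using R pos[of i] parabolic_strip_borel
        by (simp add: emeasure_parabolic_strip)
      then show "ennreal (\<theta> i) * emeasure lebesgue (S i)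
          = ennreal 800 * ennreal (\<theta> i * \<rho> i * R i powr (2 * 1))"
        using pos[of i] R
        by (simp add: ennreal_mult[symmetric] power2_eq_square mult_ac del: ennreal_numeral)
    qed
    also have "\<dots> = ennreal 800 * (\<Sum>i. ennreal (\<theta> i * \<rho> i * R i powr (2 * 1)))"
      by (rule ennreal_suminf_cmult)
    finally show ?thesis .
  qed
  \<comment> \<open>With the constant on the left, the bound becomes a common lower bound for all
    costs in the infimum; it is multiplied back afterwards.\<close>
  have "emeasure lebesgue E / ennreal 800 \<le> tendril_content 1 E"
    unfolding tendril_content_def
  proof (rule Inf_greatest, clarify)
    fix \<theta> z \<rho> R
    assume "tendril_cover E \<theta> z \<rho> R"
    from bound[OF this]
    show "emeasure lebesgue E / ennreal 800 \<le> (\<Sum>i. ennreal (\<theta> i * \<rho> i * R i powr (2 * 1)))"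
      by (intro divide_le_posI_ennreal) (auto simp: mult.commute)
  qed
  then have "ennreal 800 * (emeasure lebesgue E / ennreal 800) \<le> ennreal 800 * tendril_content 1 E"
    by (rule mult_left_mono) simp
  then show ?thesis
    by (simp add: ennreal_times_divide mult.commute[of "800::ennreal"] ennreal_mult_divide_eq)
qed

subsection \<open>Dyadic parabolic boxes\<close>

text \<open>The factors \<open>2 ^ n\<close> and \<open>4 ^ n\<close> respect parabolic scaling:
  cells have width \<open>1 / 2 ^ n\<close> and height the square of that. Taking floors makes the
  cells half-open, so those of one level partition the plane.\<close>

definition dyadic_index :: "nat \<Rightarrow> real \<times> real \<Rightarrow> int \<times> int" where
  "dyadic_index n x = (\<lfloor>fst x * 2 ^ n\<rfloor>, \<lfloor>snd x * 4 ^ n\<rfloor>)"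

definition dyadic_box :: "nat \<Rightarrow> int \<times> int \<Rightarrow> (real \<times> real) set" where
  "dyadic_box n k = {x. dyadic_index n x = k}"

lemma dyadic_box_eq:
  "dyadic_box n k = {of_int (fst k) / 2 ^ n..<(of_int (fst k) + 1) / 2 ^ n} \<times>
                    {of_int (snd k) / 4 ^ n..<(of_int (snd k) + 1) / 4 ^ n}"
proof (rule set_eqI)
  fix x
  have "x \<in> dyadic_box n k \<longleftrightarrow> \<lfloor>fst x * 2 ^ n\<rfloor> = fst k \<and> \<lfloor>snd x * 4 ^ n\<rfloor> = snd k"
    by (simp add: dyadic_box_def dyadic_index_def prod_eq_iff)
  also have "\<dots> \<longleftrightarrow> x \<in> {of_int (fst k) / 2 ^ n..<(of_int (fst k) + 1) / 2 ^ n} \<times>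
                    {of_int (snd k) / 4 ^ n..<(of_int (snd k) + 1) / 4 ^ n}"
    by (simp add: floor_eq_iff mem_Times_iff field_simps)
  finally show "x \<in> dyadic_box n k \<longleftrightarrow> \<dots>" .
qed

lemma dyadic_box_borel: "dyadic_box n k \<in> sets borel"
proof -
  have "dyadic_box n k \<in> sets (borel \<Otimes>\<^sub>M borel)"
    unfolding dyadic_box_eq by (rule pair_measureI) auto
  then show ?thesis by (simp only: borel_prod)
qed

lemma emeasure_dyadic_box: "emeasure lebesgue (dyadic_box n k) = ennreal ((1 / 2 ^ n) ^ 3)"
proof -
  have "emeasure lebesgue (dyadic_box n k) = emeasure (lborel \<Otimes>\<^sub>M lborel) (dyadic_box n k)"
    using dyadic_box_borel by (simp add: lborel_prod)
  also have "\<dots> = ennreal (1 / 2 ^ n) * ennreal (1 / 4 ^ n)"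
    unfolding dyadic_box_eq
    by (subst lborel.emeasure_pair_measure_Times)
       (simp_all add: divide_right_mono diff_divide_distrib[symmetric])
  also have "\<dots> = ennreal ((1 / 2 ^ n) ^ 3)"
    by (simp add: ennreal_mult[symmetric] power3_eq_cube power_mult_distrib[symmetric])
  finally show ?thesis .
qed

text \<open>The tendril is centred at the lower left corner of the cell. Enlargement by 4 absorbs
  the off-centre position, and the parameter \<open>t = 0\<close> already reaches every point of the
  cell.\<close>

lemma dyadic_box_subset_tendril:
  "dyadic_box n k \<subseteq> tendril (of_int (fst k) / 2 ^ n, of_int (snd k) / 4 ^ n) (1 / 2 ^ n) (1 / 2 ^ n)"
    (is "_ \<subseteq> tendril ?z ?\<rho> _")
proof
  fix x assume x: "x \<in> dyadic_box n k"
  have "?\<rho>\<^sup>2 = 1 / 4 ^ n"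
    by (simp add: power2_eq_square power_mult_distrib[symmetric])
  moreover have "0 \<le> fst x - fst ?z" "fst x - fst ?z \<le> ?\<rho>"
    "0 \<le> snd x - snd ?z" "snd x - snd ?z \<le> 1 / 4 ^ n"
    using x by (auto simp: dyadic_box_eq mem_Times_iff add_divide_distrib)
  moreover have "0 < ?\<rho>" "(0::real) < 1 / 4 ^ n" by simp_all
  ultimately have "x - ?z \<in> {-(4 * ?\<rho>)..4 * ?\<rho>} \<times> {-((4 * ?\<rho>)\<^sup>2)..(4 * ?\<rho>)\<^sup>2}"
    unfolding mem_Times_iff power_mult_distrib atLeastAtMost_iff fst_diff snd_diff
    by (intro conjI) simp_all
  then have "x \<in> parabolic_box ?z (4 * ?\<rho>)"
    unfolding parabolic_box_def by (intro CollectI exI[of _ "x - ?z"]) simp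
  then show "x \<in> tendril ?z ?\<rho> ?\<rho>"
    unfolding tendril_def by (intro CollectI exI[of _ x] exI[of _ 0]) (simp add: zero_prod_def[symmetric])
qed

text \<open>The floor of \<open>w\<close> is the integer quotient of the floor of
  \<open>w * k\<close> by \<open>k\<close>, so a finer grid determines the coarser one.\<close>

lemma floor_eq_if_floor_mult_eq:
  fixes x y :: real and k :: nat
  assumes "\<lfloor>x * real k\<rfloor> = \<lfloor>y * real k\<rfloor>" "0 < k"
  shows "\<lfloor>x\<rfloor> = \<lfloor>y\<rfloor>"
proof -
  have "\<lfloor>w\<rfloor> = \<lfloor>w * real k\<rfloor> div int k" for w
    using floor_divide_real_eq_div[of "int k" "w * real k"] assms(2) by simp
  with assms(1) show ?thesis by metis
qed

text \<open>Dyadic cells are nested: passing from level \<open>m\<close> to level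
  \<open>m + d\<close> refines the two coordinates by the integers \<open>2 ^ d\<close> and
  \<open>4 ^ d\<close>.\<close>

lemma dyadic_index_mono:
  assumes "dyadic_index n x = dyadic_index n y" "m \<le> n"
  shows "dyadic_index m x = dyadic_index m y"
proof -
  obtain d where n: "n = m + d" using assms(2) le_Suc_ex by blast
  have "\<lfloor>fst x * 2 ^ m\<rfloor> = \<lfloor>fst y * 2 ^ m\<rfloor>"
    by (rule floor_eq_if_floor_mult_eq[of _ "2 ^ d"])
       (use assms(1) in \<open>simp_all add: n dyadic_index_def power_add mult_ac\<close>)
  moreover have "\<lfloor>snd x * 4 ^ m\<rfloor> = \<lfloor>snd y * 4 ^ m\<rfloor>"
    by (rule floor_eq_if_floor_mult_eq[of _ "4 ^ d"])
       (use assms(1) in \<open>simp_all add: n dyadic_index_def power_add mult_ac\<close>)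
  ultimately show ?thesis by (simp add: dyadic_index_def)
qed

lemma dist_le_if_dyadic_index_eq:
  assumes "dyadic_index n x = dyadic_index n y"
  shows "dist x y \<le> 2 / 2 ^ n"
proof -
  have close: "\<bar>u - v\<bar> \<le> 1 / c" if "\<lfloor>u * c\<rfloor> = \<lfloor>v * c\<rfloor>" "0 < c" for u v c :: real
  proof -
    have "\<bar>u * c - v * c\<bar> \<le> 1" using that(1) by linarith
    also have "\<bar>u * c - v * c\<bar> = \<bar>u - v\<bar> * c"
      using that(2) by (simp add: abs_mult left_diff_distrib[symmetric])
    finally show ?thesis using that(2) by (simp add: field_simps)
  qed
  have "\<bar>fst x - fst y\<bar> \<le> 1 / 2 ^ n" "\<bar>snd x - snd y\<bar> \<le> 1 / 4 ^ n"
    using assms by (auto simp: dyadic_index_def intro: close)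
  moreover have "(1::real) / 4 ^ n \<le> 1 / 2 ^ n"
    by (intro divide_left_mono power_mono) auto
  moreover have "dist x y \<le> \<bar>fst x - fst y\<bar> + \<bar>snd x - snd y\<bar>"
    using sqrt_sum_squares_le_sum_abs[of "fst x - fst y" "snd x - snd y"]
    by (simp add: dist_prod_def dist_real_def)
  ultimately show ?thesis by linarith
qed

text \<open>Each cell of a partition of \<open>U\<close> enters the cover with weight 1 and
  \<open>R = \<rho>\<close>, hence costs exactly its own measure; disjointness keeps the total below
  the measure of \<open>U\<close>.\<close>

lemma tendril_content_open_le:
  assumes U: "open U" and EU: "E \<subseteq> U"
  shows "tendril_content 1 E \<le> emeasure lebesgue U"
proof -
  \<comment> \<open>The largest dyadic boxes contained in \<open>U\<close> around its points partition \<open>U\<close>.\<close>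
  define N where "N x = (LEAST n. dyadic_box n (dyadic_index n x) \<subseteq> U)" for x
  have ex: "\<exists>n. dyadic_box n (dyadic_index n x) \<subseteq> U" if "x \<in> U" for x
  proof -
    obtain e where e: "0 < e" "ball x e \<subseteq> U" using U \<open>x \<in> U\<close> openE by blast
    \<comment> \<open>This choice makes the diameter bound \<open>2 / 2 ^ n\<close> of a cell
      smaller than \<open>e\<close>.\<close>
    obtain n where n: "(1 / 2) ^ n < e / 2"
      using real_arch_pow_inv[of "e / 2" "1 / 2"] e by auto
    have "y \<in> ball x e" if "y \<in> dyadic_box n (dyadic_index n x)" for y
      using dist_le_if_dyadic_index_eq[of n x y] that n by (simp add: dyadic_box_def power_one_over)
    then show ?thesis using e by blast
  qed
  have NU: "dyadic_box (N x) (dyadic_index (N x) x) \<subseteq> U" if "x \<in> U" for x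
    unfolding N_def by (rule LeastI_ex[OF ex[OF that]])
  \<comment> \<open>The minimal level is constant on a selected cell: a coarser admissible cell
    around \<open>y\<close> would, by nesting, also contain \<open>x\<close> and contradict
    minimality for \<open>x\<close>.\<close>
  have N_eq: "N y = N x" if x: "x \<in> U" and eq: "dyadic_index (N x) y = dyadic_index (N x) x" for x y
    unfolding N_def[of y]
  proof (rule Least_equality)
    show "dyadic_box (N x) (dyadic_index (N x) y) \<subseteq> U"
      using NU[OF x] eq by simp
    show "N x \<le> m" if m: "dyadic_box m (dyadic_index m y) \<subseteq> U" for m
    proof (rule ccontr)
      assume lt: "\<not> N x \<le> m"
      then have "dyadic_index m y = dyadic_index m x"
        using dyadic_index_mono[OF eq] by simp
      with m have "N x \<le> m" unfolding N_def by (simp add: Least_le)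
      with lt show False by simp
    qed
  qed

  \<comment> \<open>An enumeration of all levels and indices, since covers are sequences.
    Surjectivity ensures that every point is covered, injectivity that the pieces \<open>A i\<close>
    are disjoint.\<close>
  define g :: "nat \<Rightarrow> nat \<times> int \<times> int" where "g = from_nat_into UNIV"
  have g: "bij g"
  proof -
    have "infinite (UNIV :: (nat \<times> int \<times> int) set)"
      by (simp add: finite_prod)
    then show ?thesis unfolding g_def by (intro bij_betw_from_nat_into) auto
  qed
  define A where "A i = {x \<in> U. (N x, dyadic_index (N x) x) = g i}" for i
  \<comment> \<open>A cell is selected as a whole or not at all, because the minimal level does not
    vary on it.\<close>
  have A: "A i = {} \<or> A i = dyadic_box (fst (g i)) (snd (g i))" for i
  proof (cases "A i = {}")
    case False
    then obtain x where x: "x \<in> U" and gi: "g i = (N x, dyadic_index (N x) x)"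
      by (auto simp: A_def)
    have "y \<in> A i \<longleftrightarrow> dyadic_index (N x) y = dyadic_index (N x) x" for y
    proof
      assume eq: "dyadic_index (N x) y = dyadic_index (N x) x"
      then have "y \<in> U" using NU[OF x] by (auto simp: dyadic_box_def)
      with N_eq[OF x eq] eq show "y \<in> A i" by (simp add: A_def gi)
    qed (auto simp: A_def gi)
    then have "A i = dyadic_box (fst (g i)) (snd (g i))"
      by (auto simp: dyadic_box_def gi)
    then show ?thesis ..
  qed simp

  \<comment> \<open>Cells that are not selected stay in the sequence with weight 0, so that they
    cost nothing while their side lengths remain positive as a cover demands.\<close>
  define \<theta> :: "nat \<Rightarrow> real" where "\<theta> i = (if A i = {} then 0 else 1)" for i
  define \<rho> :: "nat \<Rightarrow> real" where "\<rho> i = 1 / 2 ^ fst (g i)" for i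
  define z :: "nat \<Rightarrow> real \<times> real" where
    "z i = (of_int (fst (snd (g i))) / 2 ^ fst (g i), of_int (snd (snd (g i))) / 4 ^ fst (g i))" for i
  have cover: "tendril_cover E \<theta> z \<rho> \<rho>"
    unfolding tendril_cover_def
  proof (intro conjI allI AE_I2)
    fix x
    show "indicator E x \<le> (\<Sum>i. ennreal (\<theta> i) * indicator (tendril (z i) (\<rho> i) (\<rho> i)) x)"
    proof (cases "x \<in> E")
      case True
      then have "x \<in> U" using EU by blast
      moreover obtain i where "g i = (N x, dyadic_index (N x) x)"
        using bij_is_surj[OF g] by (metis surjD)
      ultimately have i: "x \<in> A i" by (simp add: A_def)
      then have "x \<in> tendril (z i) (\<rho> i) (\<rho> i)"
        using A[of i] dyadic_box_subset_tendril[of "fst (g i)" "snd (g i)"]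
        by (auto simp: z_def \<rho>_def)
      \<comment> \<open>The single term of the cell containing \<open>x\<close> already contributes
        1.\<close>
      then have "indicator E x = (\<Sum>j\<in>{i}. ennreal (\<theta> j) * indicator (tendril (z j) (\<rho> j) (\<rho> j)) x)"
        using i True by (auto simp: \<theta>_def)
      also have "\<dots> \<le> (\<Sum>j. ennreal (\<theta> j) * indicator (tendril (z j) (\<rho> j) (\<rho> j)) x)"
        by (rule sum_le_suminf) auto
      finally show ?thesis .
    qed simp
  qed (auto simp: \<theta>_def \<rho>_def)

  have A_sets: "A i \<in> sets lebesgue" for i
    using A[of i] dyadic_box_borel[of "fst (g i)" "snd (g i)"]
    by (auto simp del: prod.collapse split_paired_All)
  have cost: "ennreal (\<theta> i * \<rho> i * \<rho> i powr (2 * 1)) = emeasure lebesgue (A i)" for i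
  proof (cases "A i = {}")
    case False
    have "\<rho> i * \<rho> i powr (2 * 1) = \<rho> i ^ 3"
      by (simp add: \<rho>_def power2_eq_square power3_eq_cube)
    with False A[of i] show ?thesis
      by (simp add: \<theta>_def \<rho>_def emeasure_dyadic_box)
  qed (simp add: \<theta>_def)
  have "disjoint_family A"
    using bij_is_inj[OF g] by (auto simp: disjoint_family_on_def A_def inj_eq)
  then have "(\<Sum>i. emeasure lebesgue (A i)) = emeasure lebesgue (\<Union>i. A i)"
    using A_sets by (intro suminf_emeasure) auto
  also have "\<dots> \<le> emeasure lebesgue U"
    using U by (intro emeasure_mono) (auto simp: A_def)
  finally have "(\<Sum>i. ennreal (\<theta> i * \<rho> i * \<rho> i powr (2 * 1))) \<le> emeasure lebesgue U"
    by (simp only: cost)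
  with cover show ?thesis
    unfolding tendril_content_def by (intro Inf_lower2) auto
qed

text \<open>Outer regularity supplies an open superset exceeding \<open>E\<close> by measure less
  than \<open>e\<close>, which reduces the claim to open sets.\<close>

lemma tendril_content_le_emeasure:
  assumes E: "E \<in> sets lebesgue"
  shows "tendril_content 1 E \<le> emeasure lebesgue E"
proof (rule ennreal_le_epsilon)
  fix e :: real assume "0 < e"
  then obtain U where U: "open U" "E \<subseteq> U" "U - E \<in> lmeasurable"
    "emeasure lebesgue (U - E) < ennreal e"
    using sets_lebesgue_outer_open[OF E] by blast
  have "tendril_content 1 E \<le> emeasure lebesgue U"
    by (rule tendril_content_open_le[OF U(1,2)])
  also have "U = E \<union> (U - E)" using U(2) by blast
  also have "emeasure lebesgue \<dots> \<le> emeasure lebesgue E + emeasure lebesgue (U - E)"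
    using E U(3) by (intro emeasure_subadditive) (auto dest: fmeasurableD)
  also have "\<dots> \<le> emeasure lebesgue E + ennreal e"
    using U(4) by (intro add_left_mono) simp
  finally show "tendril_content 1 E \<le> emeasure lebesgue E + ennreal e" .
qed

subsection \<open>Comparison of the quasi-norms\<close>

text \<open>For \<open>p = 1\<close> the root is trivial, and the infinite value is preserved by the
  case distinction in the definition.\<close>

lemma weak_tendril_norm_1: "weak_tendril_norm 1 f = weak_tendril_norm_pow 1 f"
  by (simp add: weak_tendril_norm_def ennreal_enn2real_if)

context
  fixes f :: "real \<times> real \<Rightarrow> 'b::euclidean_space"
  assumes f: "f \<in> borel_measurable lebesgue"
begin

lemma superlevel_lebesgue: "{x. norm (f x) > \<alpha>} \<in> sets lebesgue"
proof -
  have "(\<lambda>x. norm (f x)) \<in> borel_measurable lebesgue" using f by measurable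
  then have "{x \<in> space lebesgue. norm (f x) > \<alpha>} \<in> sets lebesgue"
    by (rule borel_measurable_less[OF borel_measurable_const])
  then show ?thesis by simp
qed

text \<open>The content and the measure of a superlevel set are compared at the same \<alpha>, and
  the inequality passes to the suprema.\<close>

lemma weak_tendril_norm_pow_le: "weak_tendril_norm_pow 1 f \<le> weak_L1_norm f"
  unfolding weak_tendril_norm_pow_def weak_L1_norm_def
proof (rule SUP_mono)
  fix \<alpha> :: real assume \<alpha>: "\<alpha> \<in> {0<..}"
  have "ennreal (\<alpha> powr 1) * tendril_content 1 {x. norm (f x) > \<alpha>}
      \<le> ennreal \<alpha> * emeasure lebesgue {x. norm (f x) > \<alpha>}"
    using \<alpha> by (intro mult_mono tendril_content_le_emeasure superlevel_lebesgue) auto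
  with \<alpha> show "\<exists>\<beta>\<in>{0<..}. ennreal (\<alpha> powr 1) * tendril_content 1 {x. norm (f x) > \<alpha>}
      \<le> ennreal \<beta> * emeasure lebesgue {x. norm (f x) > \<beta>}" ..
qed

lemma weak_L1_norm_le: "weak_L1_norm f \<le> ennreal 800 * weak_tendril_norm_pow 1 f"
  unfolding weak_L1_norm_def
proof (rule SUP_least)
  fix \<alpha> :: real assume \<alpha>: "\<alpha> \<in> {0<..}"
  have "ennreal \<alpha> * emeasure lebesgue {x. norm (f x) > \<alpha>}
      \<le> ennreal \<alpha> * (ennreal 800 * tendril_content 1 {x. norm (f x) > \<alpha>})"
    by (intro mult_left_mono emeasure_le_tendril_content superlevel_lebesgue) simp
  also have "\<dots> = ennreal 800 * (ennreal (\<alpha> powr 1) * tendril_content 1 {x. norm (f x) > \<alpha>})"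
    using \<alpha> by (simp add: mult_ac)
  also have "\<dots> \<le> ennreal 800 * weak_tendril_norm_pow 1 f"
    unfolding weak_tendril_norm_pow_def using \<alpha> by (intro mult_left_mono SUP_upper) auto
  finally show "ennreal \<alpha> * emeasure lebesgue {x. norm (f x) > \<alpha>} \<le> \<dots>" .
qed

end

theorem proposition4p7:
  shows "weak_tendril_space 1 = (weak_L1 :: (real \<times> real \<Rightarrow> 'b::euclidean_space) set) \<and>
    (\<exists>c C :: real. 0 < c \<and> 0 < C \<and>
      (\<forall>f \<in> (weak_L1 :: (real \<times> real \<Rightarrow> 'b) set).
         ennreal c * weak_L1_norm f \<le> weak_tendril_norm 1 f \<and>
         weak_tendril_norm 1 f \<le> ennreal C * weak_L1_norm f))"
proof -
  \<comment> \<open>The two-sided comparison makes both quantities finite for the same measurable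
    functions, which gives equality of the spaces.\<close>
  have "weak_tendril_norm_pow 1 f < \<infinity> \<longleftrightarrow> weak_L1_norm f < \<infinity>"
    if f: "f \<in> borel_measurable lebesgue" for f :: "real \<times> real \<Rightarrow> 'b"
  proof
    assume "weak_tendril_norm_pow 1 f < \<infinity>"
    then have "ennreal 800 * weak_tendril_norm_pow 1 f < \<infinity>"
      by (simp add: ennreal_mult_less_top)
    with weak_L1_norm_le[OF f] show "weak_L1_norm f < \<infinity>" by (rule le_less_trans)
  qed (rule le_less_trans[OF weak_tendril_norm_pow_le[OF f]])
  then have spaces: "weak_tendril_space 1 = (weak_L1 :: (real \<times> real \<Rightarrow> 'b) set)"
    by (auto simp: weak_tendril_space_def weak_L1_def)
  have lower: "ennreal (1 / 800) * weak_L1_norm f \<le> weak_tendril_norm 1 f"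
    if f: "f \<in> borel_measurable lebesgue" for f :: "real \<times> real \<Rightarrow> 'b"
  proof -
    have "ennreal (1 / 800) * weak_L1_norm f
        \<le> ennreal (1 / 800) * (ennreal 800 * weak_tendril_norm_pow 1 f)"
      by (intro mult_left_mono weak_L1_norm_le f) simp
    also have "\<dots> = weak_tendril_norm 1 f"
      by (simp only: mult.assoc[symmetric] ennreal_mult[symmetric]) (simp add: weak_tendril_norm_1)
    finally show ?thesis .
  qed
  have upper: "weak_tendril_norm 1 f \<le> ennreal 1 * weak_L1_norm f"
    if "f \<in> borel_measurable lebesgue" for f :: "real \<times> real \<Rightarrow> 'b"
    using weak_tendril_norm_pow_le[OF that] by (simp add: weak_tendril_norm_1)
  show ?thesis
    \<comment> \<open>The witness \<open>1 / 800\<close> comes from the area of the strips, the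
      witness 1 from the exact cost of dyadic cells.\<close>
    by (rule conjI[OF spaces], rule exI[of _ "1 / 800"], rule exI[of _ 1], intro conjI ballI)
       (simp_all add: weak_L1_def lower upper del: ennreal_1)
qed

end
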